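(* Let $\alpha$ be an irrational number with simple continued fraction expansion $\alpha=[b_0;b_1,b_2,\ldots]$ and convergents $p_n/q_n$. Then the irrationality exponent $\mu(\alpha)$ and the irrationality base $\beta(\alpha)$ are given by $$\mu(\alpha)=1+\limsup_{n\to\infty}\frac{\ln q_{n+1}}{\ln q_n}=2+\limsup_{n\to\infty}\frac{\ln b_{n+1}}{\ln q_n},$$ $$\ln\beta(\alpha)=\limsup_{n\to\infty}\frac{\ln q_{n+1}}{q_n}=\limsup_{n\to\infty}\frac{\ln b_{n+1}}{q_n}.$$
   Context: Irrationality exponent: for a real irrational number $\alpha$, $\mu(\alpha)$ is the least real $\mu>0$ such that for every $\varepsilon>0$ there is a positive integer $q(\varepsilon)$ with $\left|\alpha-\frac pq\right|>q^{-(\mu+\varepsilon)}$ for all integers $p,q$ with $q\ge q(\varepsilon)$; if no such $\mu$ exists, $\mu(\alpha)=\infty$. Irrationality base: $\beta(\alpha)$ is the least real $\beta\ge 1$ such that for every $\varepsilon>0$ there is a positive integer $q(\varepsilon)$ with $\left|\alpha-\frac pq\right|>\frac{1}{(\beta+\varepsilon)^q}$ for all integers $p,q$ with $q\ge q(\varepsilon)$; if no such $\beta$ exists, $\beta(\alpha)=\infty$. Conventions: $b_0$ is an integer, $b_1,b_2,\ldots$ are positive integers, and $[b_0;b_1,b_2,\ldots]=b_0+\cfrac{1}{b_1+\cfrac{1}{b_2+\cdots}}$. The $n$-th convergent $p_n/q_n=[b_0;b_1,\ldots,b_n]$ is in lowest terms with $q_n>0$ (so $q_0=1$, $q_1=b_1$,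 $q_{n+1}=b_{n+1}q_n+q_{n-1}$). The equalities hold in the extended reals, with $\ln\infty=\infty$. *)

theory Defs
  imports "HOL-Library.Extended_Real"
begin

definition least_or_infinity :: "(real \<Rightarrow> bool) \<Rightarrow> ereal" where
  "least_or_infinity P =
     (if \<exists>x. P x \<and> (\<forall>y. P y \<longrightarrow> x \<le> y) then ereal (LEAST x. P x) else \<infinity>)"

definition irrationality_exponent :: "real \<Rightarrow> ereal" where
  "irrationality_exponent \<alpha> = least_or_infinity (\<lambda>\<mu>. \<mu> > 0 \<and>
     (\<forall>\<epsilon>>0. \<exists>Q::int. Q > 0 \<and> (\<forall>p q::int. q \<ge> Q \<longrightarrow>
        \<bar>\<alpha> - of_int p / of_int q\<bar> > of_int q powr (- (\<mu> + \<epsilon>)))))"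

definition irrationality_base :: "real \<Rightarrow> ereal" where
  "irrationality_base \<alpha> = least_or_infinity (\<lambda>\<beta>. \<beta> \<ge> 1 \<and>
     (\<forall>\<epsilon>>0. \<exists>Q::int. Q > 0 \<and> (\<forall>p q::int. q \<ge> Q \<longrightarrow>
        \<bar>\<alpha> - of_int p / of_int q\<bar> > 1 / (\<beta> + \<epsilon>) powi q)))"

(* The class ln contains only normed algebras, so ereal cannot be an instance of it.
   The values at nonpositive arguments are irrelevant here: irrationality bases are \<ge> 1. *)
definition ln_ereal :: "ereal \<Rightarrow> ereal" where
  "ln_ereal x = (if x = \<infinity> then \<infinity> else if x \<le> 0 then - \<infinity> else ereal (ln (real_of_ereal x)))"

(* The value of the finite continued fraction [b 0; b 1, ..., b n]. *)
fun cf_convergent :: "(nat \<Rightarrow> int) \<Rightarrow> nat \<Rightarrow> rat" where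
  "cf_convergent b 0 = of_int (b 0)"
| "cf_convergent b (Suc n) = of_int (b 0) + 1 / cf_convergent (\<lambda>k. b (Suc k)) n"

(* quotient_of yields the representation in lowest terms with positive denominator. *)
definition cf_denom :: "(nat \<Rightarrow> int) \<Rightarrow> nat \<Rightarrow> int" where
  "cf_denom b n = snd (quotient_of (cf_convergent b n))"

definition simple_cf_expansion :: "(nat \<Rightarrow> int) \<Rightarrow> real \<Rightarrow> bool" where
  "simple_cf_expansion b \<alpha> \<longleftrightarrow>
     (\<forall>n\<ge>1. b n > 0) \<and> (\<lambda>n. of_rat (cf_convergent b n)) \<longlonglongrightarrow> \<alpha>"

end

(* Two convergents whose indices differ by k satisfy
   |p (n+k) q n - p n q (n+k)| q (n+1) <= q (n+k), since both sides obey recurrences with the same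
   positive coefficients; letting k grow gives |alpha - p n / q n| <= 1 / (q n q (n+1)). Conversely,
   a denominator s < q (n+1) satisfies |s alpha - r| >= 1 / (4 q (n+1)), because r/s differs from a
   nearby convergent. Hence a lower bound exp (- y g(s)) on |alpha - r/s|, where g is ln or the
   identity, is governed by the growth of ln q (n+1) relative to g(q n), and this is exactly what
   the limits superior measure. The b (n+1) versions follow from
   b (n+1) q n <= q (n+1) <= 2 b (n+1) q n. *)

theory Submission
  imports Defs "HOL-Analysis.Extended_Real_Limits" "HOL-Real_Asymp.Real_Asymp"
begin

section \<open>Limits superior and least elements\<close>

text \<open>Puts a bound on a limit superior into the same "for every \<epsilon>" form in which both
  irrationality measures are defined.\<close>

lemma limsup_ereal_le_iff:
  "limsup (\<lambda>n. ereal (f n)) \<le> ereal c \<longleftrightarrow>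
     (\<forall>\<epsilon>>0. \<forall>\<^sub>F n in sequentially. f n \<le> c + \<epsilon>)"
proof
  assume le: "limsup (\<lambda>n. ereal (f n)) \<le> ereal c"
  show "\<forall>\<epsilon>>0. \<forall>\<^sub>F n in sequentially. f n \<le> c + \<epsilon>"
  proof (intro allI impI)
    fix \<epsilon> :: real
    assume "\<epsilon> > 0"
    then have "\<forall>\<^sub>F n in sequentially. ereal (f n) < ereal (c + \<epsilon>)"
      using le unfolding Limsup_le_iff
      by (metis ereal_less(2) less_add_same_cancel1 ereal_less_eq(3) linorder_not_le)
    then show "\<forall>\<^sub>F n in sequentially. f n \<le> c + \<epsilon>"
      by (rule eventually_mono) simp
  qed
next
  assume ev: "\<forall>\<epsilon>>0. \<forall>\<^sub>F n in sequentially. f n \<le> c + \<epsilon>"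
  show "limsup (\<lambda>n. ereal (f n)) \<le> ereal c"
  proof (rule ereal_le_epsilon2)
    fix \<epsilon> :: real
    assume "\<epsilon> > 0"
    then have "\<forall>\<^sub>F n in sequentially. f n \<le> c + \<epsilon>"
      using ev by blast
    then have "\<forall>\<^sub>F n in sequentially. ereal (f n) \<le> ereal c + ereal \<epsilon>"
      by (rule eventually_mono) simp
    then show "limsup (\<lambda>n. ereal (f n)) \<le> ereal c + ereal \<epsilon>"
      by (rule Limsup_bounded)
  qed
qed

text \<open>Used to pass from \<open>q (Suc n)\<close> to \<open>b (Suc n)\<close>: only the
  difference of the two sequences has to converge, and the limits superior may be infinite.\<close>

lemma limsup_add_real:
  assumes "(\<lambda>n. g n - f n) \<longlonglongrightarrow> c"
  shows "limsup (\<lambda>n. ereal (g n)) = ereal c + limsup (\<lambda>n. ereal (f n))"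
proof -
  have "limsup (\<lambda>n. ereal (g n - f n) + ereal (f n)) = ereal c + limsup (\<lambda>n. ereal (f n))"
    using assms by (intro ereal_limsup_lim_add) auto
  then show ?thesis
    by simp
qed

text \<open>A set of reals of the form \<open>L \<le> x\<close> has least element \<open>L\<close>
  when \<open>L\<close> is finite and is empty when \<open>L = \<infinity>\<close>. For
  \<open>L = - \<infinity>\<close> it would be all reals, with no least element and hence the value
  \<infinity>, so this case is excluded.\<close>

lemma least_or_infinity_eqI:
  assumes "\<And>x. P x \<longleftrightarrow> L \<le> ereal x" "L \<noteq> - \<infinity>"
  shows "least_or_infinity P = L"
proof (cases L)
  case (real l)
  then have P: "P x \<longleftrightarrow> l \<le> x" for x
    by (simp add: assms)
  then have "(LEAST x. P x) = l"
    by (intro Least_equality) auto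
  then show ?thesis
    using P real by (auto simp: least_or_infinity_def)
qed (use assms in \<open>auto simp: least_or_infinity_def\<close>)

lemma ex_pos_bound_iff_eventually:
  "(\<exists>Q::int. Q > 0 \<and> (\<forall>r s. s \<ge> Q \<longrightarrow> R r s)) \<longleftrightarrow> (\<forall>\<^sub>F s in at_top. \<forall>r. R r s)"
proof
  assume "\<forall>\<^sub>F s in at_top. \<forall>r. R r s"
  then obtain Q where "\<forall>s\<ge>Q. \<forall>r. R r s"
    unfolding eventually_at_top_linorder by blast
  then show "\<exists>Q::int. Q > 0 \<and> (\<forall>r s. s \<ge> Q \<longrightarrow> R r s)"
    by (intro exI[of _ "max Q 1"]) auto
qed (auto simp: eventually_at_top_linorder)

section \<open>Convergents\<close>

text \<open>Numerators and denominators as continuants: the recurrences extend the fraction at its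
  end, whereas \<open>cf_convergent\<close> unfolds it from the front.\<close>

fun cf_p :: "(nat \<Rightarrow> int) \<Rightarrow> nat \<Rightarrow> int" where
  "cf_p b 0 = b 0"
| "cf_p b (Suc 0) = b 1 * b 0 + 1"
| "cf_p b (Suc (Suc n)) = b (Suc (Suc n)) * cf_p b (Suc n) + cf_p b n"

fun cf_q :: "(nat \<Rightarrow> int) \<Rightarrow> nat \<Rightarrow> int" where
  "cf_q b 0 = 1"
| "cf_q b (Suc 0) = b 1"
| "cf_q b (Suc (Suc n)) = b (Suc (Suc n)) * cf_q b (Suc n) + cf_q b n"

text \<open>Together with \<open>cf_q_shift\<close>, reconciles the two directions: removing
  \<open>b 0\<close> acts linearly on the pair of numerator and denominator.\<close>

lemma cf_p_shift:
  "cf_p b (Suc n) = b 0 * cf_p (\<lambda>k. b (Suc k)) n + cf_q (\<lambda>k. b (Suc k)) n"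
  by (induction n rule: induct_nat_012) (simp_all add: algebra_simps)

lemma cf_q_shift: "cf_q b (Suc n) = cf_p (\<lambda>k. b (Suc k)) n"
  by (induction n rule: induct_nat_012) (simp_all add: algebra_simps)

lemma cf_q_pos:
  assumes "\<forall>n\<ge>1. b n > 0"
  shows "cf_q b n > 0"
  using assms by (induction n rule: induct_nat_012) (simp_all add: add_pos_pos)

lemma cf_convergent_eq:
  assumes "\<forall>n\<ge>1. b n > 0"
  shows "cf_convergent b n = of_int (cf_p b n) / of_int (cf_q b n)"
  using assms
proof (induction n arbitrary: b)
  case (Suc n)
  have "cf_q b (Suc n) > 0"
    using Suc.prems by (rule cf_q_pos)
  moreover have "cf_convergent (\<lambda>k. b (Suc k)) n
      = of_int (cf_p (\<lambda>k. b (Suc k)) n) / of_int (cf_q (\<lambda>k. b (Suc k)) n)"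
    using Suc by simp
  ultimately show ?case
    by (simp add: cf_q_shift cf_p_shift field_simps)
qed simp

lemma cf_det: "cf_p b (Suc n) * cf_q b n - cf_p b n * cf_q b (Suc n) = (-1) ^ n"
  by (induction n) (simp_all add: algebra_simps)

text \<open>A common divisor divides the determinant, which is 1 or -1. Hence
  \<open>quotient_of\<close> returns exactly this pair.\<close>

lemma coprime_cf_p_q: "coprime (cf_p b n) (cf_q b n)"
proof (rule coprimeI)
  fix c assume "c dvd cf_p b n" "c dvd cf_q b n"
  then have "c dvd cf_p b (Suc n) * cf_q b n - cf_p b n * cf_q b (Suc n)"
    by simp
  then have "c dvd (-1) ^ n"
    by (simp only: cf_det)
  then show "is_unit c"
    by (metis dvd_trans is_unit_power_iff dvd_minus_iff dvd_refl)
qed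

lemma cf_denom_eq:
  assumes "\<forall>n\<ge>1. b n > 0"
  shows "cf_denom b n = cf_q b n"
proof -
  have "cf_convergent b n = Fract (cf_p b n) (cf_q b n)"
    using cf_convergent_eq[OF assms] by (simp add: Fract_of_int_quotient)
  then show ?thesis
    using cf_q_pos[OF assms] coprime_cf_p_q
    by (simp add: cf_denom_def quotient_of_Fract normalize_stable)
qed

locale simple_cf =
  fixes b :: "nat \<Rightarrow> int" and \<alpha> :: real
  assumes expansion: "simple_cf_expansion b \<alpha>"
begin

abbreviation "p \<equiv> cf_p b"
abbreviation "q \<equiv> cf_q b"

lemma b_pos: "n \<ge> 1 \<Longrightarrow> b n > 0"
  using expansion by (simp add: simple_cf_expansion_def)

lemma q_pos: "q n > 0"
  using b_pos by (simp add: cf_q_pos)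

lemma convergents_tendsto: "(\<lambda>n. of_int (p n) / of_int (q n)) \<longlonglongrightarrow> \<alpha>"
proof -
  have "real_of_rat (cf_convergent b n) = of_int (p n) / of_int (q n)" for n
    using b_pos by (subst cf_convergent_eq) (simp_all add: of_rat_divide)
  then show ?thesis
    using expansion by (simp add: simple_cf_expansion_def)
qed

section \<open>Growth of the denominators\<close>

lemma b_mult_q_le: "b (Suc n) * q n \<le> q (Suc n)"
  using q_pos by (cases n) (simp_all add: less_imp_le)

lemma q_le_Suc: "q n \<le> q (Suc n)"
proof -
  have "1 * q n \<le> b (Suc n) * q n"
    using b_pos[of "Suc n"] q_pos[of n] by (intro mult_right_mono) auto
  then show ?thesis
    using b_mult_q_le[of n] by simp
qed

lemma q_mono: "m \<le> n \<Longrightarrow> q m \<le> q n"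
  by (rule lift_Suc_mono_le[of q, OF q_le_Suc])

lemma q_Suc_Suc_ge: "q (Suc n) + q n \<le> q (Suc (Suc n))"
proof -
  have "1 * q (Suc n) \<le> b (Suc (Suc n)) * q (Suc n)"
    using b_pos[of "Suc (Suc n)"] q_pos[of "Suc n"] by (intro mult_right_mono) auto
  then show ?thesis
    by simp
qed

text \<open>The factor 2 absorbs the second term of the recurrence, which is at most
  \<open>q n\<close> and so at most \<open>b (Suc n) * q n\<close>.\<close>

lemma q_Suc_le: "q (Suc n) \<le> 2 * b (Suc n) * q n"
proof (cases n)
  case (Suc m)
  have "q m \<le> q n"
    by (simp add: Suc q_le_Suc)
  also have "q n = 1 * q n"
    by simp
  also have "\<dots> \<le> b (Suc n) * q n"
    using b_pos[of "Suc n"] q_pos[of n] by (intro mult_right_mono) auto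
  finally show ?thesis
    by (simp add: Suc algebra_simps)
qed (use b_pos[of 1] in simp)

lemma ln_q_nonneg: "0 \<le> ln (q n)"
proof -
  have "1 \<le> q n"
    using q_pos[of n] by linarith
  then show ?thesis
    by simp
qed

lemma ln_q_Suc_bounds:
  shows "ln (b (Suc n)) + ln (q n) \<le> ln (q (Suc n))"
    and "ln (q (Suc n)) \<le> ln 2 + ln (b (Suc n)) + ln (q n)"
proof -
  have pos: "real_of_int (b (Suc n)) > 0" "real_of_int (q n) > 0" "real_of_int (q (Suc n)) > 0"
    using q_pos b_pos[of "Suc n"] by simp_all
  have "real_of_int (b (Suc n) * q n) \<le> q (Suc n)"
    using b_mult_q_le by (simp only: of_int_le_iff)
  then have "ln (real_of_int (b (Suc n) * q n)) \<le> ln (q (Suc n))"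
    using pos by (intro ln_mono) simp_all
  then show "ln (b (Suc n)) + ln (q n) \<le> ln (q (Suc n))"
    using pos by (simp add: ln_mult)
  have "real_of_int (q (Suc n)) \<le> real_of_int (2 * b (Suc n) * q n)"
    using q_Suc_le by (simp only: of_int_le_iff)
  then have "ln (q (Suc n)) \<le> ln (real_of_int (2 * b (Suc n) * q n))"
    using pos by (intro ln_mono) simp_all
  then show "ln (q (Suc n)) \<le> ln 2 + ln (b (Suc n)) + ln (q n)"
    using pos by (simp add: ln_mult)
qed

lemma q_ge: "int n \<le> q n"
proof (induction n)
  case (Suc n)
  show ?case
  proof (cases n)
    case 0
    then show ?thesis using b_pos[of 1] by simp
  next
    case (Suc m)
    then show ?thesis
      using q_Suc_Suc_ge[of m] q_pos[of m] Suc.IH unfolding Suc by linarith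
  qed
qed simp

lemma filterlim_q: "filterlim q at_top sequentially"
  by (rule filterlim_at_top_mono[OF filterlim_int_sequentially always_eventually])
     (use q_ge in blast)

lemma filterlim_real_q: "filterlim (\<lambda>n. real_of_int (q n)) at_top sequentially"
  by (rule filterlim_compose[OF filterlim_real_of_int_at_top filterlim_q])

section \<open>Approximation by convergents\<close>

text \<open>The start of the induction is 0 for \<open>k = 0\<close> and, by \<open>cf_det\<close>,
  an equality for \<open>k = 1\<close>. After division by the denominators the bound no longer
  depends on \<open>k\<close>, so it survives the limit.\<close>

lemma convergent_diff_le:
  "\<bar>p (n + k) * q n - p n * q (n + k)\<bar> * q (Suc n) \<le> q (n + k)"
proof (induction k rule: induct_nat_012)
  case 0
  show ?case using q_pos[of n] by simp
next
  case 1
  show ?case by (simp add: cf_det)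
next
  case (ge2 k)
  let ?u = "\<lambda>m. p m * q n - p n * q m"
  have b: "b (n + Suc (Suc k)) > 0"
    by (rule b_pos) simp
  have "?u (n + Suc (Suc k)) = b (n + Suc (Suc k)) * ?u (n + Suc k) + ?u (n + k)"
    by (simp add: algebra_simps)
  then have "\<bar>?u (n + Suc (Suc k))\<bar> \<le> b (n + Suc (Suc k)) * \<bar>?u (n + Suc k)\<bar> + \<bar>?u (n + k)\<bar>"
    using b abs_triangle_ineq[of "b (n + Suc (Suc k)) * ?u (n + Suc k)" "?u (n + k)"]
    by (simp add: abs_mult)
  then have "\<bar>?u (n + Suc (Suc k))\<bar> * q (Suc n)
      \<le> (b (n + Suc (Suc k)) * \<bar>?u (n + Suc k)\<bar> + \<bar>?u (n + k)\<bar>) * q (Suc n)"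
    using q_pos[of "Suc n"] by (intro mult_right_mono) auto
  also have "\<dots> = b (n + Suc (Suc k)) * (\<bar>?u (n + Suc k)\<bar> * q (Suc n)) + \<bar>?u (n + k)\<bar> * q (Suc n)"
    by (simp add: algebra_simps)
  also have "\<dots> \<le> b (n + Suc (Suc k)) * q (n + Suc k) + q (n + k)"
    using ge2 b by (intro add_mono mult_left_mono) auto
  finally show ?case
    by simp
qed

lemma convergent_error_le: "\<bar>\<alpha> - p n / q n\<bar> \<le> 1 / (q n * q (Suc n))"
proof (rule tendsto_upperbound)
  show "(\<lambda>m. \<bar>of_int (p m) / of_int (q m) - p n / q n\<bar>) \<longlonglongrightarrow> \<bar>\<alpha> - p n / q n\<bar>"
    by (intro tendsto_intros convergents_tendsto)
  show "\<forall>\<^sub>F m in sequentially. \<bar>of_int (p m) / of_int (q m) - p n / q n\<bar> \<le> 1 / (q n * q (Suc n))"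
    using eventually_ge_at_top[of n]
  proof eventually_elim
    case (elim m)
    have pos: "real_of_int (q m) > 0" "real_of_int (q n) > 0" "real_of_int (q (Suc n)) > 0"
      using q_pos by simp_all
    have "\<bar>p m * q n - p n * q m\<bar> * q (Suc n) \<le> q m"
      using convergent_diff_le[of n "m - n"] elim by simp
    then have "real_of_int (\<bar>p m * q n - p n * q m\<bar> * q (Suc n)) \<le> q m"
      by (simp only: of_int_le_iff)
    moreover have "\<bar>of_int (p m) / of_int (q m) - p n / q n\<bar>
        = \<bar>p m * q n - p n * q m\<bar> / (q m * q n)"
      using pos by (simp add: diff_frac_eq abs_mult)
    ultimately show ?case
      using pos by (simp add: field_simps)
  qed
qed simp

lemma convergent_form_le: "\<bar>q n * \<alpha> - p n\<bar> \<le> 1 / q (Suc n)"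
proof -
  have "q n * \<alpha> - p n = q n * (\<alpha> - p n / q n)"
    using q_pos[of n] by (simp add: right_diff_distrib)
  then have "\<bar>q n * \<alpha> - p n\<bar> = q n * \<bar>\<alpha> - p n / q n\<bar>"
    using q_pos[of n] by (simp add: abs_mult)
  also have "\<dots> \<le> q n * (1 / (q n * q (Suc n)))"
    using q_pos[of n] by (intro mult_left_mono convergent_error_le) simp
  finally show ?thesis
    using q_pos[of n] by simp
qed

text \<open>As \<open>p n\<close> and \<open>q n\<close> are coprime and \<open>0 < s < q n\<close>,
  the integer \<open>r * q n - s * p n\<close> is nonzero. Written as
  \<open>s * (q n * \<alpha> - p n) - q n * (s * \<alpha> - r)\<close>, its first part is at most
  1/2 in absolute value, which leaves at least 1/2 for the second.\<close>

lemma form_ge_aux: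
  fixes r s :: int
  assumes "0 < s" "s < q n" "2 * s \<le> q (Suc n)"
  shows "1 / (2 * q n) \<le> \<bar>s * \<alpha> - r\<bar>"
proof -
  have pos: "real_of_int (q n) > 0" "real_of_int (q (Suc n)) > 0"
    using q_pos by simp_all
  have "r * q n \<noteq> s * p n"
  proof
    assume "r * q n = s * p n"
    then have "q n dvd s * p n"
      by (metis dvd_triv_right)
    then have "q n dvd s"
      using coprime_cf_p_q[of b n] by (simp add: coprime_commute coprime_dvd_mult_left_iff)
    then show False
      using assms zdvd_imp_le by fastforce
  qed
  then have "1 \<le> \<bar>r * q n - s * p n\<bar>"
    by simp
  then have "1 \<le> real_of_int \<bar>r * q n - s * p n\<bar>"
    by (simp only: of_int_1_le_iff)
  also have "\<dots> = \<bar>real_of_int r * q n - s * p n\<bar>"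
    by simp
  also have "real_of_int r * q n - s * p n = s * (q n * \<alpha> - p n) - q n * (s * \<alpha> - r)"
    by (simp add: algebra_simps)
  also have "\<bar>\<dots>\<bar> \<le> s * \<bar>q n * \<alpha> - p n\<bar> + q n * \<bar>s * \<alpha> - r\<bar>"
    using pos assms(1) abs_triangle_ineq4[of "s * (q n * \<alpha> - p n)" "q n * (s * \<alpha> - r)"]
    by (simp add: abs_mult)
  also have "s * \<bar>q n * \<alpha> - p n\<bar> \<le> s * (1 / q (Suc n))"
    using assms(1) by (intro mult_left_mono convergent_form_le) simp
  also have "\<dots> \<le> 1 / 2"
  proof -
    have "2 * real_of_int s \<le> q (Suc n)"
      using assms(3) by linarith
    then show ?thesis
      using pos by (simp add: field_simps)
  qed
  finally show ?thesis
    using pos by (simp add: field_simps)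
qed

text \<open>If \<open>s\<close> exceeds \<open>q (n + 2) / 2\<close>, then \<open>q (n + 2) < 2 * q (n + 1)\<close>, so nothing but a
  factor 2 is lost by comparing with the convergent of index \<open>n + 2\<close> instead.\<close>

lemma form_ge:
  fixes r s :: int
  assumes "0 < s" "s < q (Suc n)"
  shows "1 / (4 * q (Suc n)) \<le> \<bar>s * \<alpha> - r\<bar>"
proof (cases "2 * s \<le> q (Suc (Suc n))")
  case True
  have "1 / (4 * q (Suc n)) \<le> 1 / (2 * q (Suc n))"
    using q_pos[of "Suc n"] by (simp add: field_simps)
  also have "\<dots> \<le> \<bar>s * \<alpha> - r\<bar>"
    using assms True by (intro form_ge_aux)
  finally show ?thesis .
next
  case False
  \<comment> \<open>The second bound holds because \<open>q (n + 3)\<close> is at least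
    \<open>q (n + 2) + q (n + 1)\<close> and both summands exceed \<open>s\<close>.\<close>
  have "s < q (Suc (Suc n))" "2 * s \<le> q (Suc (Suc (Suc n)))"
    using assms q_le_Suc[of "Suc n"] q_Suc_Suc_ge[of "Suc n"] by linarith+
  then have "1 / (2 * q (Suc (Suc n))) \<le> \<bar>s * \<alpha> - r\<bar>"
    using assms by (intro form_ge_aux)
  moreover have "real_of_int (q (Suc (Suc n))) \<le> 2 * real_of_int (q (Suc n))"
    using False assms by linarith
  then have "1 / (4 * q (Suc n)) \<le> 1 / (2 * q (Suc (Suc n)))"
    using q_pos[of "Suc n"] q_pos[of "Suc (Suc n)"]
    by (simp add: field_simps del: cf_q.simps)
  ultimately show ?thesis
    by linarith
qed

section \<open>Growth of denominators versus approximation by all rationals\<close>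

text \<open>Enclose \<open>s\<close> by \<open>q n \<le> s < q (Suc n)\<close>. Then
  \<open>q (Suc n)\<close> is at most \<open>exp (z * g (q n))\<close>, hence at most
  \<open>exp (z * g s)\<close>, and \<open>form_ge\<close> applies; the factor \<open>s\<close>
  comes from dividing the linear form by \<open>s\<close>. Keeping \<open>g\<close> general serves
  the exponent (\<open>ln\<close>) and the base (identity) at once.\<close>

lemma approx_lower_bound:
  fixes g :: "real \<Rightarrow> real"
  assumes g: "mono_on {1..} g" and z: "z \<ge> 0"
    and ev: "\<forall>\<^sub>F n in sequentially. ln (q (Suc n)) \<le> z * g (q n)"
  shows "\<forall>\<^sub>F s::int in at_top. \<forall>r::int. exp (- (z * g s)) / (4 * s) \<le> \<bar>\<alpha> - r / s\<bar>"
proof -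
  obtain N where N: "\<And>n. n \<ge> N \<Longrightarrow> ln (q (Suc n)) \<le> z * g (q n)"
    using ev by (auto simp: eventually_sequentially)
  show ?thesis
    using eventually_ge_at_top[of "q N"]
  proof eventually_elim
    case (elim s)
    have s: "s > 0"
      using elim q_pos[of N] by linarith
    define m where "m = (LEAST m. s < q m)"
    have "s < q (Suc (nat s))"
      using q_ge[of "Suc (nat s)"] by linarith
    then have m: "s < q m"
      unfolding m_def by (rule LeastI)
    have le: "q k \<le> s" if "k < m" for k
      using not_less_Least[OF that[unfolded m_def]] by simp
    \<comment> \<open>Since \<open>q N \<le> s\<close>, the first denominator above \<open>s\<close>
      has index beyond \<open>N\<close>; its predecessor \<open>n\<close> is therefore in the range
      of the growth bound.\<close>
    have "N < m"
      using m elim q_mono[of m N] by (meson leI less_le_trans not_le)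
    then obtain n where n: "m = Suc n" "n \<ge> N"
      by (cases m) auto
    have "ln (q (Suc n)) \<le> z * g (q n)"
      using N n by simp
    also have "\<dots> \<le> z * g s"
      using le[of n] n z s q_pos[of n] by (intro mult_left_mono mono_onD[OF g]) auto
    finally have "exp (- (z * g s)) \<le> exp (- ln (q (Suc n)))"
      by simp
    also have "\<dots> = 1 / q (Suc n)"
      using q_pos[of "Suc n"] by (simp add: exp_minus divide_inverse)
    finally have *: "exp (- (z * g s)) / (4 * s) \<le> 1 / q (Suc n) / (4 * s)"
      using s by (intro divide_right_mono) auto
    show ?case
    proof
      fix r :: int
      note *
      also have "1 / q (Suc n) / (4 * s) = 1 / (4 * q (Suc n)) / s"
        by simp
      also have "\<dots> \<le> \<bar>s * \<alpha> - r\<bar> / s"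
        using s m n by (intro divide_right_mono form_ge) auto
      also have "\<dots> = \<bar>(s * \<alpha> - r) / s\<bar>"
        using s by simp
      also have "(s * \<alpha> - r) / s = \<alpha> - r / s"
        using s by (simp add: field_simps)
      finally show "exp (- (z * g s)) / (4 * s) \<le> \<bar>\<alpha> - r / s\<bar>" .
    qed
  qed
qed

text \<open>The gap \<open>y - z\<close> pays for the factor \<open>4 * s\<close>. For
  \<open>g = ln\<close> this needs a gap above 1, for the identity any positive gap suffices; this
  is why the exponent formula carries an extra 1 and the base formula does not.\<close>

lemma exp_lower_bound:
  fixes g :: "real \<Rightarrow> real"
  assumes "mono_on {1..} g" "z \<ge> 0"
    and "\<forall>\<^sub>F n in sequentially. ln (q (Suc n)) \<le> z * g (q n)"
    and g: "\<forall>\<^sub>F t in at_top. ln (4 * t) < (y - z) * g t"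
  shows "\<forall>\<^sub>F s::int in at_top. \<forall>r::int. exp (- (y * g s)) < \<bar>\<alpha> - r / s\<bar>"
  using approx_lower_bound[OF assms(1-3)] eventually_gt_at_top[of 0]
    eventually_compose_filterlim[OF g filterlim_real_of_int_at_top]
proof eventually_elim
  case (elim s)
  have "exp (- (y * g s)) < exp (- (z * g s) - ln (4 * s))"
    using elim(3) by (simp add: algebra_simps)
  also have "\<dots> = exp (- (z * g s)) / (4 * s)"
    using elim(2) by (simp add: exp_diff)
  finally show ?case
    using elim(1) by (meson less_le_trans)
qed

text \<open>The assumed lower bound is tested at the convergents, where it meets the upper bound
  \<open>convergent_error_le\<close>.\<close>

lemma ln_q_less_of_exp_bound:
  fixes g :: "real \<Rightarrow> real"
  assumes "\<forall>\<^sub>F s::int in at_top. \<forall>r::int. exp (- (y * g s)) < \<bar>\<alpha> - r / s\<bar>"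
  shows "\<forall>\<^sub>F n in sequentially. ln (q n) + ln (q (Suc n)) < y * g (q n)"
  using eventually_compose_filterlim[OF assms filterlim_q]
proof eventually_elim
  case (elim n)
  have pos: "real_of_int (q n) > 0" "real_of_int (q (Suc n)) > 0"
    using q_pos by simp_all
  have "exp (- (y * g (q n))) < 1 / (q n * q (Suc n))"
    using elim convergent_error_le[of n] less_le_trans by blast
  also have "\<dots> = exp (- (ln (q n) + ln (q (Suc n))))"
    using pos by (simp add: exp_minus exp_add divide_inverse del: minus_add_distrib)
  finally show ?case
    by simp
qed

lemma eventually_ln_q_gt: "\<forall>\<^sub>F n in sequentially. ln (q n) > c"
  by (rule filterlim_at_top_dense[THEN iffD1, rule_format,
      OF filterlim_compose[OF ln_at_top filterlim_real_q]])

section \<open>Irrationality exponent\<close>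

text \<open>In one direction the summand \<open>ln (q n)\<close> of
  \<open>ln_q_less_of_exp_bound\<close> turns \<mu> into \<open>\<mu> - 1\<close>; in the other, the
  division by \<open>s\<close> costs the same 1.\<close>

lemma exponent_bound_iff:
  "(\<mu> > 0 \<and> (\<forall>\<epsilon>>0. \<exists>Q::int. Q > 0 \<and> (\<forall>r s::int. s \<ge> Q \<longrightarrow>
      \<bar>\<alpha> - of_int r / of_int s\<bar> > of_int s powr (- (\<mu> + \<epsilon>))))) \<longleftrightarrow>
   (\<forall>\<epsilon>>0. \<forall>\<^sub>F n in sequentially. ln (q (Suc n)) / ln (q n) \<le> \<mu> - 1 + \<epsilon>)"
  (is "?L \<longleftrightarrow> ?R")
proof -
  have powr: "(\<forall>\<^sub>F s::int in at_top. \<forall>r::int. of_int s powr (- y) < \<bar>\<alpha> - of_int r / of_int s\<bar>)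
      \<longleftrightarrow> (\<forall>\<^sub>F s::int in at_top. \<forall>r::int. exp (- (y * ln s)) < \<bar>\<alpha> - r / s\<bar>)" for y
    by (rule eventually_cong[OF eventually_gt_at_top[of 0]]) (simp add: powr_def)
  have L: "?L \<longleftrightarrow> \<mu> > 0 \<and> (\<forall>\<epsilon>>0. \<forall>\<^sub>F s::int in at_top. \<forall>r::int.
      exp (- ((\<mu> + \<epsilon>) * ln s)) < \<bar>\<alpha> - r / s\<bar>)"
    unfolding ex_pos_bound_iff_eventually powr ..
  \<comment> \<open>This supplies \<open>\<mu> > 0\<close> and the nonnegative slope
    \<open>z\<close> when starting from the right-hand side, which does not mention them.\<close>
  have ge1: "\<forall>\<^sub>F n in sequentially. 1 \<le> ln (q (Suc n)) / ln (q n)"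
    using eventually_ln_q_gt[of 0]
  proof eventually_elim
    case (elim n)
    then show ?case
      using q_le_Suc[of n] q_pos[of n] by (simp add: field_simps)
  qed
  show ?thesis
  proof
    assume ?L
    then have ev: "\<forall>\<^sub>F s::int in at_top. \<forall>r::int. exp (- ((\<mu> + \<epsilon>) * ln s)) < \<bar>\<alpha> - r / s\<bar>"
      if "\<epsilon> > 0" for \<epsilon>
      using L that by blast
    show ?R
    proof (intro allI impI)
      fix \<epsilon> :: real assume "\<epsilon> > 0"
      from ln_q_less_of_exp_bound[of "\<mu> + \<epsilon>" ln, OF ev[OF this]] eventually_ln_q_gt[of 0]
      show "\<forall>\<^sub>F n in sequentially. ln (q (Suc n)) / ln (q n) \<le> \<mu> - 1 + \<epsilon>"
        by eventually_elim (simp add: field_simps)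
    qed
  next
    assume R: ?R
    have ge: "1 \<le> \<mu> - 1 + \<epsilon>" if "\<epsilon> > 0" for \<epsilon>
    proof -
      have "\<forall>\<^sub>F n in sequentially. ln (q (Suc n)) / ln (q n) \<le> \<mu> - 1 + \<epsilon>"
        using R that by blast
      from eventually_conj[OF this ge1] show ?thesis
        by (auto simp: eventually_sequentially intro: order_trans)
    qed
    show ?L
      unfolding L
    proof (intro conjI allI impI)
      show "\<mu> > 0"
        using ge[of 1] by simp
      fix \<epsilon> :: real assume \<epsilon>: "\<epsilon> > 0"
      show "\<forall>\<^sub>F s::int in at_top. \<forall>r::int. exp (- ((\<mu> + \<epsilon>) * ln s)) < \<bar>\<alpha> - r / s\<bar>"
      proof (rule exp_lower_bound)
        show "mono_on {1..} (ln :: real \<Rightarrow> real)"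
          by (auto intro!: mono_onI)
        show "0 \<le> \<mu> - 1 + \<epsilon> / 2"
          using ge[of "\<epsilon> / 2"] \<epsilon> by simp
        have "\<forall>\<^sub>F n in sequentially. ln (q (Suc n)) / ln (q n) \<le> \<mu> - 1 + \<epsilon> / 2"
          using R half_gt_zero[OF \<epsilon>] by blast
        then show "\<forall>\<^sub>F n in sequentially. ln (q (Suc n)) \<le> (\<mu> - 1 + \<epsilon> / 2) * ln (q n)"
          using eventually_ln_q_gt[of 0] by eventually_elim (simp add: field_simps)
        \<comment> \<open>Spending only half of \<epsilon> on the slope leaves a gap of
          \<open>1 + \<epsilon> / 2\<close>, just above the critical value 1.\<close>
        have "\<forall>\<^sub>F t in at_top. ln (4 * t) < (1 + \<epsilon> / 2) * ln t"
          using \<epsilon> by real_asymp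
        then show "\<forall>\<^sub>F t in at_top. ln (4 * t) < (\<mu> + \<epsilon> - (\<mu> - 1 + \<epsilon> / 2)) * ln t"
          by (simp add: algebra_simps)
      qed
    qed
  qed
qed

text \<open>By \<open>ln_q_Suc_bounds\<close> the two quotients differ by at least 1 and at most
  \<open>1 + ln 2 / ln (q n)\<close> once \<open>ln (q n) > 0\<close>.\<close>

lemma limsup_ln_q_ratio:
  "limsup (\<lambda>n. ereal (ln (q (Suc n)) / ln (q n))) = 1 + limsup (\<lambda>n. ereal (ln (b (Suc n)) / ln (q n)))"
proof -
  have "(\<lambda>n. ln (q (Suc n)) / ln (q n) - ln (b (Suc n)) / ln (q n)) \<longlonglongrightarrow> 1"
  proof (rule tendsto_sandwich)
    show "\<forall>\<^sub>F n in sequentially. 1 \<le> ln (q (Suc n)) / ln (q n) - ln (b (Suc n)) / ln (q n)"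
      using eventually_ln_q_gt[of 0]
    proof eventually_elim
      case (elim n)
      then show ?case
        using ln_q_Suc_bounds(1)[of n] by (simp add: field_simps)
    qed
    show "\<forall>\<^sub>F n in sequentially. ln (q (Suc n)) / ln (q n) - ln (b (Suc n)) / ln (q n)
        \<le> 1 + ln 2 / ln (q n)"
      using eventually_ln_q_gt[of 0]
    proof eventually_elim
      case (elim n)
      then show ?case
        using divide_right_mono[OF ln_q_Suc_bounds(2)[of n], of "ln (q n)"]
        by (simp add: add_divide_distrib)
    qed
    have "((\<lambda>t::real. 1 + ln 2 / ln t) \<longlongrightarrow> 1) at_top"
      by real_asymp
    then show "(\<lambda>n. 1 + ln 2 / ln (q n)) \<longlonglongrightarrow> 1"
      by (rule filterlim_compose[OF _ filterlim_real_q])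
  qed simp
  from limsup_add_real[OF this] show ?thesis
    by (simp flip: one_ereal_def)
qed

theorem irrationality_exponent_eq:
  "irrationality_exponent \<alpha> = 1 + limsup (\<lambda>n. ereal (ln (q (Suc n)) / ln (q n)))" (is "_ = 1 + ?l")
  unfolding irrationality_exponent_def
proof (rule least_or_infinity_eqI)
  fix \<mu> :: real
  have "1 + ?l \<le> ereal \<mu> \<longleftrightarrow> ?l \<le> ereal (\<mu> - 1)"
    by (cases ?l) auto
  then show "(\<mu> > 0 \<and> (\<forall>\<epsilon>>0. \<exists>Q::int. Q > 0 \<and> (\<forall>r s::int. s \<ge> Q \<longrightarrow>
      \<bar>\<alpha> - of_int r / of_int s\<bar> > of_int s powr (- (\<mu> + \<epsilon>))))) \<longleftrightarrow> 1 + ?l \<le> ereal \<mu>"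
    by (simp only: exponent_bound_iff limsup_ereal_le_iff)
next
  \<comment> \<open>This holds termwise even where \<open>ln (q n) = 0\<close>, as at
    \<open>n = 0\<close>: division by zero gives 0.\<close>
  have "0 \<le> ?l"
    by (intro le_Limsup) (auto intro!: always_eventually divide_nonneg_nonneg ln_q_nonneg)
  then show "1 + ?l \<noteq> - \<infinity>"
    by auto
qed

section \<open>Irrationality base\<close>

text \<open>Here \<open>g\<close> is the identity. The summand \<open>ln (q n)\<close> is simply
  dropped in one direction, and \<open>ln (4 * t)\<close> is negligible against \<open>t\<close> in
  the other, so no shift appears.\<close>

lemma base_bound_iff:
  assumes \<beta>: "\<beta> \<ge> 1"
  shows "(\<forall>\<epsilon>>0. \<exists>Q::int. Q > 0 \<and> (\<forall>r s::int. s \<ge> Q \<longrightarrow>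
      \<bar>\<alpha> - of_int r / of_int s\<bar> > 1 / (\<beta> + \<epsilon>) powi s)) \<longleftrightarrow>
   (\<forall>\<epsilon>>0. \<forall>\<^sub>F n in sequentially. ln (q (Suc n)) / q n \<le> ln \<beta> + \<epsilon>)"
  (is "?L \<longleftrightarrow> ?R")
proof -
  have powi: "1 / y powi s = exp (- (ln y * s))" if "y > 0" for y :: real and s :: int
    using that by (simp add: powr_def exp_minus divide_inverse mult.commute flip: powr_real_of_int')
  have L: "?L \<longleftrightarrow> (\<forall>\<epsilon>>0. \<forall>\<^sub>F s::int in at_top. \<forall>r::int.
      exp (- (ln (\<beta> + \<epsilon>) * s)) < \<bar>\<alpha> - r / s\<bar>)"
    unfolding ex_pos_bound_iff_eventually using \<beta> by (auto simp: powi)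
  show ?thesis
  proof
    assume ?L
    show ?R
    proof (intro allI impI)
      fix \<epsilon> :: real assume "\<epsilon> > 0"
      \<comment> \<open>Chosen so that enlarging \<beta> by \<delta> enlarges
        \<open>ln \<beta>\<close> by exactly \<epsilon>.\<close>
      define \<delta> where "\<delta> = \<beta> * exp \<epsilon> - \<beta>"
      have "\<delta> > 0" "ln (\<beta> + \<delta>) = ln \<beta> + \<epsilon>"
        using \<beta> \<open>\<epsilon> > 0\<close> by (auto simp: \<delta>_def ln_mult)
      then have "\<forall>\<^sub>F s::int in at_top. \<forall>r::int. exp (- ((ln \<beta> + \<epsilon>) * s)) < \<bar>\<alpha> - r / s\<bar>"
        using L[THEN iffD1, OF \<open>?L\<close>, rule_format, of \<delta>] by simp
      from ln_q_less_of_exp_bound[of _ "\<lambda>t. t", OF this]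
      show "\<forall>\<^sub>F n in sequentially. ln (q (Suc n)) / q n \<le> ln \<beta> + \<epsilon>"
      proof eventually_elim
        case (elim n)
        then have "ln (q (Suc n)) \<le> (ln \<beta> + \<epsilon>) * q n"
          using ln_q_nonneg[of n] by linarith
        then show ?case
          using q_pos[of n] by (simp add: field_simps)
      qed
    qed
  next
    assume R: ?R
    show ?L
      unfolding L
    proof (intro allI impI)
      fix \<epsilon> :: real assume \<epsilon>: "\<epsilon> > 0"
      \<comment> \<open>Half of the logarithmic gap goes into the slope, the other half beats
        \<open>ln (4 * t)\<close>.\<close>
      define \<delta> where "\<delta> = (ln (\<beta> + \<epsilon>) - ln \<beta>) / 2"
      have \<delta>: "\<delta> > 0"
        using \<beta> \<epsilon> by (simp add: \<delta>_def)
      show "\<forall>\<^sub>F s::int in at_top. \<forall>r::int. exp (- (ln (\<beta> + \<epsilon>) * s)) < \<bar>\<alpha> - r / s\<bar>"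
      proof (rule exp_lower_bound[where g = "\<lambda>t. t"])
        show "mono_on {1..} (\<lambda>t::real. t)"
          by (auto intro!: mono_onI)
        show "0 \<le> ln \<beta> + \<delta>"
          using \<beta> \<delta> by simp
        have "\<forall>\<^sub>F n in sequentially. ln (q (Suc n)) / q n \<le> ln \<beta> + \<delta>"
          using R \<delta> by blast
        then show "\<forall>\<^sub>F n in sequentially. ln (q (Suc n)) \<le> (ln \<beta> + \<delta>) * q n"
        proof eventually_elim
          case (elim n)
          then show ?case
            using q_pos[of n] by (simp add: field_simps)
        qed
        have "ln (\<beta> + \<epsilon>) - (ln \<beta> + \<delta>) = \<delta>"
          by (simp add: \<delta>_def field_simps)
        moreover have "\<forall>\<^sub>F t in at_top. ln (4 * t) < \<delta> * t"
          using \<delta> by real_asymp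
        ultimately show "\<forall>\<^sub>F t in at_top. ln (4 * t) < (ln (\<beta> + \<epsilon>) - (ln \<beta> + \<delta>)) * t"
          by (simp only:)
      qed
    qed
  qed
qed

text \<open>The difference lies between 0 and \<open>(ln 2 + ln (q n)) / q n\<close>, which vanishes
  in the limit.\<close>

lemma limsup_ln_q_over_q:
  "limsup (\<lambda>n. ereal (ln (q (Suc n)) / q n)) = limsup (\<lambda>n. ereal (ln (b (Suc n)) / q n))"
proof -
  have "(\<lambda>n. ln (q (Suc n)) / q n - ln (b (Suc n)) / q n) \<longlonglongrightarrow> 0"
  proof (rule tendsto_sandwich)
    show "\<forall>\<^sub>F n in sequentially. 0 \<le> ln (q (Suc n)) / q n - ln (b (Suc n)) / q n"
    proof (rule always_eventually, rule allI)
      fix n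
      have "ln (b (Suc n)) \<le> ln (q (Suc n))"
        using ln_q_Suc_bounds(1)[of n] ln_q_nonneg[of n] by linarith
      then show "0 \<le> ln (q (Suc n)) / q n - ln (b (Suc n)) / q n"
        using q_pos[of n] by (simp add: divide_right_mono)
    qed
    show "\<forall>\<^sub>F n in sequentially. ln (q (Suc n)) / q n - ln (b (Suc n)) / q n \<le> (ln 2 + ln (q n)) / q n"
    proof (rule always_eventually, rule allI)
      fix n
      show "ln (q (Suc n)) / q n - ln (b (Suc n)) / q n \<le> (ln 2 + ln (q n)) / q n"
        using divide_right_mono[OF ln_q_Suc_bounds(2)[of n], of "q n"] q_pos[of n]
        by (simp add: add_divide_distrib)
    qed
    have "((\<lambda>t::real. (ln 2 + ln t) / t) \<longlongrightarrow> 0) at_top"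
      by real_asymp
    then show "(\<lambda>n. (ln 2 + ln (q n)) / q n) \<longlonglongrightarrow> 0"
      by (rule filterlim_compose[OF _ filterlim_real_q])
  qed simp
  from limsup_add_real[OF this] show ?thesis
    by (simp flip: zero_ereal_def)
qed

theorem ln_irrationality_base_eq:
  "ln_ereal (irrationality_base \<alpha>) = limsup (\<lambda>n. ereal (ln (q (Suc n)) / q n))" (is "_ = ?l")
proof -
  have nonneg: "0 \<le> ?l"
    using q_pos
    by (intro le_Limsup)
      (auto intro!: always_eventually divide_nonneg_nonneg ln_q_nonneg simp: less_imp_le)
  define B where "B = (if ?l = \<infinity> then \<infinity> else ereal (exp (real_of_ereal ?l)))"
  have "irrationality_base \<alpha> = B"
    unfolding irrationality_base_def
  proof (rule least_or_infinity_eqI)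
    fix \<beta> :: real
    \<comment> \<open>As \<open>?l\<close> is nonnegative, \<open>B\<close> is at least 1, so
      \<open>B \<le> \<beta>\<close> already contains the constraint
      \<open>\<beta> \<ge> 1\<close>.\<close>
    have "\<beta> \<ge> 1 \<and> ?l \<le> ereal (ln \<beta>) \<longleftrightarrow> B \<le> ereal \<beta>"
    proof (cases ?l)
      case (real l)
      have "1 \<le> exp l"
        using real nonneg by simp
      moreover have "l \<le> ln \<beta> \<longleftrightarrow> exp l \<le> \<beta>" if "\<beta> \<ge> 1"
        using that by (simp add: ln_ge_iff)
      ultimately have "\<beta> \<ge> 1 \<and> l \<le> ln \<beta> \<longleftrightarrow> exp l \<le> \<beta>"
        by (meson order_trans)
      then show ?thesis
        using real by (simp add: B_def)
    qed (use nonneg in \<open>auto simp: B_def\<close>)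
    then show "(\<beta> \<ge> 1 \<and> (\<forall>\<epsilon>>0. \<exists>Q::int. Q > 0 \<and> (\<forall>r s::int. s \<ge> Q \<longrightarrow>
        \<bar>\<alpha> - of_int r / of_int s\<bar> > 1 / (\<beta> + \<epsilon>) powi s))) \<longleftrightarrow> B \<le> ereal \<beta>"
      \<comment> \<open>The congruence rule makes \<open>\<beta> \<ge> 1\<close> available as the
        premise of \<open>base_bound_iff\<close>.\<close>
      by (simp only: base_bound_iff limsup_ereal_le_iff cong: conj_cong)
  qed (simp add: B_def)
  then show ?thesis
    using nonneg by (cases ?l) (auto simp: B_def ln_ereal_def)
qed

end

theorem theorem1:
  fixes \<alpha> :: real and b :: "nat \<Rightarrow> int"
  assumes "\<alpha> \<notin> \<rat>"
    and "simple_cf_expansion b \<alpha>"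
  shows "(let q = (\<lambda>n. real_of_int (cf_denom b n)) in
    irrationality_exponent \<alpha> = 1 + limsup (\<lambda>n. ereal (ln (q (Suc n)) / ln (q n))) \<and>
    irrationality_exponent \<alpha> = 2 + limsup (\<lambda>n. ereal (ln (real_of_int (b (Suc n))) / ln (q n))) \<and>
    ln_ereal (irrationality_base \<alpha>) = limsup (\<lambda>n. ereal (ln (q (Suc n)) / q n)) \<and>
    ln_ereal (irrationality_base \<alpha>) = limsup (\<lambda>n. ereal (ln (real_of_int (b (Suc n))) / q n)))"
proof -
  interpret simple_cf b \<alpha>
    using assms(2) by unfold_locales
  have "cf_denom b n = q n" for n
    using b_pos by (intro cf_denom_eq) auto
  moreover have "1 + (1 + x) = 2 + x" for x :: ereal
    by (cases x) auto
  ultimately show ?thesis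
    using irrationality_exponent_eq limsup_ln_q_ratio ln_irrationality_base_eq limsup_ln_q_over_q
    by (simp add: Let_def)
qed

end
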